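(* There exists $p_0>0$ such that if $0<p\le p_0$, then there exist $p^3/6<t'<t''<1/6$ such that the variational problem $$\phi(p,t)=\inf\{I_p(f):f\in\mathcal{W},\ T(f)\ge t\}$$ is solved by the constant function $c_t\equiv(6t)^{1/3}$ when $t\in(p^3/6,t')\cup(t'',1/6)$, but there is a non-empty subset of $(t',t'')$ such that for every $t$ in it all optimizers of the variational problem are non-constant.
   Context: $\mathcal{W}$ is the set of measurable functions $f:[0,1]^2\to[0,1]$ with $f(x,y)=f(y,x)$. For $p\in(0,1)$ and $u\in[0,1]$, $I_p(u)=\frac12u\log\frac up+\frac12(1-u)\log\frac{1-u}{1-p}$ (with $0\log0=0$), and for $f\in\mathcal{W}$, $I_p(f)=\int_0^1\int_0^1I_p(f(x,y))\,dx\,dy$. For $f\in\mathcal{W}$, $T(f)=\frac16\int_0^1\int_0^1\int_0^1f(x,y)f(y,z)f(z,x)\,dx\,dy\,dz$. An optimizer (or solution) of the variational problem is an $f\in\mathcal{W}$ with $T(f)\ge t$ and $I_p(f)=\phi(p,t)$. Functions are called constant if they are almost everywhere constant on $[0,1]^2$. *)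

theory Defs
  imports "HOL-Analysis.Analysis"
begin

abbreviation unit_square :: "(real \<times> real) set" where
  "unit_square \<equiv> {0..1} \<times> {0..1}"

abbreviation unit_cube :: "(real \<times> real \<times> real) set" where
  "unit_cube \<equiv> {0..1} \<times> {0..1} \<times> {0..1}"

text \<open>
  The space \<open>\<W>\<close>. A function on \<open>[0,1]\<^sup>2\<close> is a total function of which only the
  values on the square matter; ``measurable'' means Lebesgue measurable.
\<close>

definition graphons :: "(real \<times> real \<Rightarrow> real) set" where
  "graphons = {f. f \<in> borel_measurable (lebesgue_on unit_square) \<and>
     (\<forall>x\<in>{0..1}. \<forall>y\<in>{0..1}. f (x, y) \<in> {0..1} \<and> f (x, y) = f (y, x))}"

text \<open>The convention \<open>0 log 0 = 0\<close> holds automatically, because the factor \<open>0\<close> annihilates.\<close>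

definition rel_entropy :: "real \<Rightarrow> real \<Rightarrow> real" where
  "rel_entropy p u = 1/2 * u * ln (u / p) + 1/2 * (1 - u) * ln ((1 - u) / (1 - p))"

definition entropy_fun :: "real \<Rightarrow> (real \<times> real \<Rightarrow> real) \<Rightarrow> real" where
  "entropy_fun p f = (\<integral>z. rel_entropy p (f z) \<partial>lebesgue_on unit_square)"

definition triangle_fun :: "(real \<times> real \<Rightarrow> real) \<Rightarrow> real" where
  "triangle_fun f =
     1/6 * (\<integral>(x, y, z). f (x, y) * f (y, z) * f (z, x) \<partial>lebesgue_on unit_cube)"

text \<open>
  For \<open>0 < p < 1\<close> and \<open>t \<le> 1/6\<close> the infimum is over a nonempty set of nonnegative
  reals, so the real-valued \<open>Inf\<close> is the genuine one.
\<close>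

definition phi :: "real \<Rightarrow> real \<Rightarrow> real" where
  "phi p t = (INF f \<in> {f \<in> graphons. triangle_fun f \<ge> t}. entropy_fun p f)"

definition optimizer :: "real \<Rightarrow> real \<Rightarrow> (real \<times> real \<Rightarrow> real) \<Rightarrow> bool" where
  "optimizer p t f \<longleftrightarrow> f \<in> graphons \<and> triangle_fun f \<ge> t \<and> entropy_fun p f = phi p t"

definition ae_constant :: "(real \<times> real \<Rightarrow> real) \<Rightarrow> bool" where
  "ae_constant f \<longleftrightarrow> (\<exists>c. AE z in lebesgue_on unit_square. f z = c)"

end

theory Submission
  imports Defs "HOL-Real_Asymp.Real_Asymp"
begin

text \<open>
  Two estimates decide when the constant \<open>c\<close> with \<open>c\<^sup>3 / 6 = t\<close> is optimal.

  Applying Cauchy--Schwarz twice gives \<open>(6 T(f))\<^sup>2 \<le> (\<integral> f\<^sup>2)\<^sup>3\<close>, so that \<open>T(f) \<ge> c\<^sup>3 / 6\<close> forces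
  \<open>\<integral> f\<^sup>2 \<ge> c\<^sup>2\<close> (lemma \<open>triangle_fun_ge_imp_moment_ge\<close>). Hence \<open>c\<close> is optimal as soon as
  \<open>I\<^sub>p\<close>, regarded as a function of \<open>u\<^sup>2\<close>, has a supporting line of nonnegative slope at \<open>c\<^sup>2\<close>:
  integrating \<open>I\<^sub>p(f) \<ge> I\<^sub>p(c) + \<lambda> (f\<^sup>2 - c\<^sup>2)\<close> gives the claim.

  The only candidate for the slope is \<open>\<lambda> = (logit c - logit p) / (4 c)\<close>. Subtracting the tangent
  of \<open>I\<^sub>p\<close> at \<open>c\<close> leaves \<open>I\<^sub>c\<close>, so the supporting line exists if and only if
  \<open>I\<^sub>c(u) \<ge> \<lambda> (u - c)\<^sup>2\<close> on \<open>[0,1]\<close>. For \<open>c \<noteq> 1/2\<close> the best constant in such a quadratic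
  bound is \<open>K(c) / 2\<close> with \<open>K(c) = logit c / (2 c - 1)\<close> (a form of the Kearns--Saul inequality,
  lemma \<open>rel_entropy_quadratic\<close>), and \<open>\<lambda> \<le> K(c) / 2\<close> simplifies to \<open>K(c) \<ge> - logit p\<close>. At \<open>c = p\<close>
  this inequality is strict, because \<open>K(p) = - logit p / (1 - 2 p)\<close> and \<open>p < 1/2\<close>, so it persists slightly to the
  right of \<open>p\<close>; for \<open>c \<ge> 1 - p\<close> it holds because
  \<open>K(c) \<ge> logit c \<ge> logit (1 - p) = - logit p\<close>. These are the two ranges of \<open>t\<close> with constant
  optimizers.

  In between, take \<open>t = 1/48\<close>, that is \<open>c = 1/2\<close>. Planting a clique on half of the vertices
  costs \<open>ln (1/p) / 8\<close>, whereas the constant \<open>1/2\<close> costs about \<open>ln (1/p) / 4\<close>. For small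
  \<open>p\<close> the clique is cheaper, and every admissible constant is at least as expensive as \<open>1/2\<close>.
\<close>

section \<open>Kullback--Leibler divergence and its quadratic lower bound\<close>

definition logit :: "real \<Rightarrow> real" where
  "logit u = ln (u / (1 - u))"

lemma logit_half [simp]: "logit (1/2) = 0"
  by (simp add: logit_def)

lemma logit_eq: "0 < u \<Longrightarrow> u < 1 \<Longrightarrow> logit u = ln u - ln (1 - u)"
  by (simp add: logit_def ln_div)

lemma logit_compl: "0 < u \<Longrightarrow> u < 1 \<Longrightarrow> logit (1 - u) = - logit u"
  by (simp add: logit_eq)

lemma logit_mono: "0 < a \<Longrightarrow> a \<le> b \<Longrightarrow> b < 1 \<Longrightarrow> logit a \<le> logit b"
  by (simp add: logit_eq diff_mono)

lemma continuous_on_xlnx: "continuous_on {0..} (\<lambda>x::real. x * ln x)"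
  unfolding continuous_on_eq_continuous_within
proof
  fix x :: real assume "x \<in> {0..}"
  show "continuous (at x within {0..}) (\<lambda>x. x * ln x)"
  proof (cases "x = 0")
    case True
    have "((\<lambda>x::real. x * ln x) \<longlongrightarrow> 0) (at_right 0)"
      by real_asymp
    then show ?thesis
      using True by (simp add: continuous_within at_within_Ici_at_right)
  next
    case False
    then show ?thesis
      using \<open>x \<in> {0..}\<close> by (intro continuous_intros) auto
  qed
qed

lemma rel_entropy_eq:
  assumes "0 < c" "c < 1" "u \<in> {0..1}"
  shows "rel_entropy c u =
    1/2 * (u * ln u + (1 - u) * ln (1 - u) - u * ln c - (1 - u) * ln (1 - c))"
  using assms by (cases "u = 0 \<or> u = 1") (auto simp: rel_entropy_def ln_div field_simps)

lemma continuous_on_rel_entropy: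
  assumes "0 < c" "c < 1"
  shows "continuous_on {0..1} (rel_entropy c)"
proof -
  have A: "continuous_on {0..1} (\<lambda>u::real. u * ln u)"
    by (rule continuous_on_subset[OF continuous_on_xlnx]) auto
  have B: "continuous_on {0..1} (\<lambda>u::real. (1 - u) * ln (1 - u))"
    by (rule continuous_on_compose2[OF continuous_on_xlnx]) (auto intro!: continuous_intros)
  have "continuous_on {0..1} (\<lambda>u.
      1/2 * (u * ln u + (1 - u) * ln (1 - u) - u * ln c - (1 - u) * ln (1 - c)))"
    by (intro continuous_on_mult_left continuous_on_mult_right continuous_on_diff
        continuous_on_add continuous_on_id continuous_on_const A B)
  then show ?thesis
    by (subst continuous_on_cong[OF refl rel_entropy_eq[OF assms]])
qed

lemma DERIV_rel_entropy:
  assumes "0 < c" "c < 1" "0 < u" "u < 1"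
  shows "DERIV (rel_entropy c) u :> 1/2 * (logit u - logit c)"
proof (rule has_field_derivative_transform_within_open)
  show "DERIV (\<lambda>u. 1/2 * (u * ln u + (1 - u) * ln (1 - u) - u * ln c - (1 - u) * ln (1 - c))) u
      :> 1/2 * (logit u - logit c)"
    using assms by (auto intro!: derivative_eq_intros simp: logit_eq)
  show "u \<in> {0<..<1}" using assms by simp
qed (use assms in \<open>auto simp: rel_entropy_eq\<close>)

lemma rel_entropy_nonneg:
  assumes "0 < c" "c < 1" "u \<in> {0..1}"
  shows "0 \<le> rel_entropy c u"
proof -
  have *: "v - a \<le> v * ln (v / a)" if "0 < a" "0 \<le> v" for v a :: real
  proof (cases "v = 0")
    case False
    then have "v * ln (a / v) \<le> v * (a / v - 1)"
      using that by (intro mult_left_mono ln_le_minus_one) auto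
    then show ?thesis
      using False that by (simp add: ln_div algebra_simps)
  qed (use that in auto)
  show ?thesis
    using *[of c u] *[of "1 - c" "1 - u"] assms by (simp add: rel_entropy_def)
qed

text \<open>
  The entropy \<open>I\<^sub>p\<close> is its tangent at \<open>c\<close> plus \<open>I\<^sub>c\<close>: changing the base point \<open>p\<close> alters \<open>I\<^sub>p\<close>
  only by an affine function, and \<open>I\<^sub>c\<close> vanishes to second order at \<open>c\<close>.
\<close>

lemma rel_entropy_change_base:
  assumes "0 < p" "p < 1" "0 < c" "c < 1" "u \<in> {0..1}"
  shows "rel_entropy p u =
    rel_entropy p c + 1/2 * (logit c - logit p) * (u - c) + rel_entropy c u"
  using assms by (simp add: rel_entropy_eq logit_eq field_simps)

lemma convex_on_logit: "convex_on {1/2..<1} logit"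
proof (rule f''_ge0_imp_convex)
  fix u :: real assume u: "u \<in> {1/2..<1}"
  show "DERIV logit u :> 1 / u + 1 / (1 - u)"
    using u unfolding logit_def[abs_def]
    by (auto intro!: derivative_eq_intros simp: divide_simps)
  show "DERIV (\<lambda>u. 1 / u + 1 / (1 - u)) u :> 1 / (1 - u)^2 - 1 / u^2"
    using u by (auto intro!: derivative_eq_intros simp: power2_eq_square)
  have "(1 - u)^2 \<le> u^2"
    using u by (intro power_mono) auto
  then show "0 \<le> 1 / (1 - u)^2 - 1 / u^2"
    using u by (simp add: divide_left_mono)
qed simp

text \<open>
  Chords of a convex function from a fixed point have increasing slopes; here the fixed point is
  \<open>1/2\<close>, where \<open>logit\<close> vanishes. The denominators are cleared.
\<close>

lemma logit_slope_mono:
  assumes "1/2 < a" "a \<le> b" "b < 1"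
  shows "logit a * (2 * b - 1) \<le> logit b * (2 * a - 1)"
proof -
  have "convex_on {1/2..b} logit"
    using assms by (intro convex_on_subset[OF convex_on_logit]) auto
  from convex_onD_Icc'[OF this, of a]
  have "logit a \<le> logit b / (b - 1/2) * (a - 1/2)"
    using assms by simp
  then show ?thesis
    using assms by (simp add: field_simps)
qed

lemma valley_min:
  fixes f f' :: "real \<Rightarrow> real"
  assumes cont: "continuous_on {a..b} f"
    and der: "\<And>x. a < x \<Longrightarrow> x < b \<Longrightarrow> DERIV f x :> f' x"
    and left: "\<And>x. a < x \<Longrightarrow> x < m \<Longrightarrow> f' x \<le> 0"
    and right: "\<And>x. m < x \<Longrightarrow> x < b \<Longrightarrow> 0 \<le> f' x"
    and "m \<in> {a..b}" "u \<in> {a..b}"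
  shows "f m \<le> f u"
proof (cases "u \<le> m")
  case True
  show ?thesis
  proof (rule DERIV_nonpos_imp_decreasing_open[OF True])
    show "\<exists>y. DERIV f x :> y \<and> y \<le> 0" if "u < x" "x < m" for x
      using that assms(5,6) der[of x] left[of x] by auto
    show "continuous_on {u..m} f"
      using assms(5,6) by (intro continuous_on_subset[OF cont]) auto
  qed
next
  case False
  then have "m \<le> u" by simp
  then show ?thesis
  proof (rule DERIV_nonneg_imp_increasing_open)
    show "\<exists>y. DERIV f x :> y \<and> 0 \<le> y" if "m < x" "x < u" for x
      using that assms(5,6) der[of x] right[of x] by auto
    show "continuous_on {m..u} f"
      using assms(5,6) by (intro continuous_on_subset[OF cont]) auto
  qed
qed

lemma rel_entropy_compl: "rel_entropy (1 - c) (1 - u) = rel_entropy c u"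
  by (simp add: rel_entropy_def)

text \<open>
  The difference \<open>g\<close> of the two sides has a derivative that is odd about \<open>1/2\<close> and vanishes at
  \<open>1 - c\<close>, \<open>1/2\<close> and \<open>c\<close>; the constant \<open>K\<close> is the one that produces the zero at \<open>1/2\<close>. By
  convexity of \<open>logit\<close> on the right half, \<open>g\<close> falls and then rises on each half of the
  interval, with minima at \<open>1 - c\<close> and \<open>c\<close>, and it vanishes at both.
\<close>

lemma rel_entropy_quadratic_gt_half:
  assumes c: "1/2 < c" "c < 1" and u: "u \<in> {0..1}"
  shows "logit c / (2 * c - 1) / 2 * (u - c)^2 \<le> rel_entropy c u"
proof -
  define K where "K = logit c / (2 * c - 1)"
  define g where "g v = rel_entropy c v - K / 2 * (v - c)^2" for v
  define g' where "g' v = 1/2 * (logit v - K * (2 * v - 1))" for v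
  have cK: "logit c = K * (2 * c - 1)"
    using c by (simp add: K_def)
  have cont: "continuous_on {0..1} g"
    unfolding g_def using c by (intro continuous_intros continuous_on_rel_entropy) auto
  have der: "DERIV g v :> g' v" if "0 < v" "v < 1" for v
    unfolding g_def g'_def using c that
    by (auto intro!: derivative_eq_intros DERIV_rel_entropy simp: cK field_simps)
  have g'_compl: "g' (1 - v) = - g' v" if "0 < v" "v < 1" for v
    using that by (simp add: g'_def logit_compl algebra_simps)
  have neg: "g' v \<le> 0" if "1/2 < v" "v \<le> c" for v
    using logit_slope_mono[of v c] that c by (simp add: g'_def K_def field_simps)
  have pos: "0 \<le> g' v" if "c \<le> v" "v < 1" for v
    using logit_slope_mono[of c v] that c by (simp add: g'_def K_def field_simps)
  have zero: "g c = 0"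
    using c by (simp add: g_def rel_entropy_def)
  have "g (1 - c) = 1/2 * ((2 * c - 1) * logit c) - K / 2 * (1 - 2 * c)^2"
    using c by (simp add: g_def rel_entropy_eq logit_eq algebra_simps)
  also have "\<dots> = 0"
    by (simp add: cK power2_eq_square algebra_simps)
  finally have zero': "g (1 - c) = 0" .
  have "0 \<le> g u"
  proof (cases "u \<le> 1/2")
    case True
    have "g (1 - c) \<le> g u"
    proof (rule valley_min[where f = g and m = "1 - c" and a = 0 and b = "1/2" and f' = g'])
      show "continuous_on {0..1/2} g"
        by (rule continuous_on_subset[OF cont]) auto
      show "g' v \<le> 0" if "0 < v" "v < 1 - c" for v
        using pos[of "1 - v"] g'_compl[of v] that c by simp
      show "0 \<le> g' v" if "1 - c < v" "v < 1/2" for v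
        using neg[of "1 - v"] g'_compl[of v] that c by simp
    qed (use der c u True in auto)
    then show ?thesis using zero' by simp
  next
    case False
    have "g c \<le> g u"
    proof (rule valley_min[where f = g and m = c and a = "1/2" and b = 1 and f' = g'])
      show "continuous_on {1/2..1} g"
        by (rule continuous_on_subset[OF cont]) auto
    qed (use der neg pos c u False in auto)
    then show ?thesis using zero by simp
  qed
  then show ?thesis
    by (simp add: g_def K_def)
qed

lemma rel_entropy_quadratic:
  assumes c: "0 < c" "c < 1" "c \<noteq> 1/2" and u: "u \<in> {0..1}"
  shows "logit c / (2 * c - 1) / 2 * (u - c)^2 \<le> rel_entropy c u"
proof (cases "1/2 < c")
  case True
  then show ?thesis using rel_entropy_quadratic_gt_half c u by simp
next
  case False
  have "logit (1 - c) / (2 * (1 - c) - 1) / 2 * ((1 - u) - (1 - c))^2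
      \<le> rel_entropy (1 - c) (1 - u)"
    using False c u by (intro rel_entropy_quadratic_gt_half) auto
  moreover have "logit (1 - c) / (2 * (1 - c) - 1) = logit c / (2 * c - 1)"
    using c by (simp add: logit_compl divide_simps) (simp add: algebra_simps)
  moreover have "((1 - u) - (1 - c))^2 = (u - c)^2"
    by (simp add: power2_eq_square algebra_simps)
  ultimately show ?thesis
    by (simp only: rel_entropy_compl)
qed

text \<open>
  As a function of \<open>u\<^sup>2\<close> the left-hand side is a line touching \<open>I\<^sub>p\<close> at \<open>c\<close>. The linear terms
  match in \<open>u\<^sup>2 - c\<^sup>2 = 2 c (u - c) + (u - c)\<^sup>2\<close>, and the remaining quadratic one is
  absorbed by \<open>rel_entropy_quadratic\<close>; the hypothesis \<open>slope\<close> says that its coefficient is small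
  enough.
\<close>

lemma rel_entropy_supporting_parabola:
  assumes p: "0 < p" "p \<le> c" and c: "c < 1" "c \<noteq> 1/2"
    and slope: "- logit p \<le> logit c / (2 * c - 1)"
    and u: "u \<in> {0..1}"
  shows "rel_entropy p c + (logit c - logit p) / (4 * c) * (u^2 - c^2) \<le> rel_entropy p u"
proof -
  define K where "K = logit c / (2 * c - 1)"
  have cK: "logit c = K * (2 * c - 1)"
    using c by (simp add: K_def)
  have "(logit c - logit p) / (4 * c) \<le> K / 2"
    using slope p unfolding K_def[symmetric] by (simp add: cK field_simps)
  then have "(logit c - logit p) / (4 * c) * (u - c)^2 \<le> K / 2 * (u - c)^2"
    by (intro mult_right_mono) auto
  also have "\<dots> \<le> rel_entropy c u"
    using rel_entropy_quadratic[of c u] p c u by (simp add: K_def)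
  finally have "(logit c - logit p) / (4 * c) * (u - c)^2 \<le> rel_entropy c u" .
  moreover have "(logit c - logit p) / (4 * c) * (u^2 - c^2) =
      1/2 * (logit c - logit p) * (u - c) + (logit c - logit p) / (4 * c) * (u - c)^2"
    using p by (simp add: field_simps power2_eq_square)
  ultimately show ?thesis
    using rel_entropy_change_base[of p c u] p c u by simp
qed

section \<open>Triangle density is bounded by the second moment\<close>

text \<open>
  Cauchy--Schwarz in \<open>(x, y)\<close> separates \<open>g(x, y)\<close> from \<open>G(x, y) = \<integral> g(y, z) g(z, x) dz\<close>;
  Cauchy--Schwarz in \<open>z\<close> then bounds \<open>G(x, y)\<^sup>2\<close> by a function of \<open>y\<close> times a function of \<open>x\<close>,
  each with integral \<open>\<integral> g\<^sup>2\<close>.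
\<close>

lemma Cauchy_Schwarz_cycle:
  fixes g :: "real \<times> real \<Rightarrow> ennreal"
  assumes [measurable]: "g \<in> borel_measurable borel"
  shows "(\<integral>\<^sup>+(x, y, z). g (x, y) * g (y, z) * g (z, x) \<partial>lborel)\<^sup>2
    \<le> (\<integral>\<^sup>+w. (g w)\<^sup>2 \<partial>lborel) ^ 3"
proof -
  define S where "S = (\<integral>\<^sup>+w. (g w)\<^sup>2 \<partial>lborel)"
  define G where "G x y = (\<integral>\<^sup>+z. g (y, z) * g (z, x) \<partial>lborel)" for x y
  have [measurable]: "g \<in> borel_measurable (borel \<Otimes>\<^sub>M borel)"
    by (simp add: borel_prod)
  have [measurable]: "(\<lambda>(x, y). G x y) \<in> borel_measurable (borel \<Otimes>\<^sub>M borel)"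
    unfolding G_def by measurable
  have fst: "(\<integral>\<^sup>+w. h w \<partial>lborel) = (\<integral>\<^sup>+x. \<integral>\<^sup>+y. h (x, y) \<partial>lborel \<partial>lborel)"
    if "h \<in> borel_measurable borel" for h :: "real \<times> real \<Rightarrow> ennreal"
    using that lborel.nn_integral_fst[of h "lborel :: real measure"]
    by (simp add: lborel_prod borel_prod)
  have fst3: "(\<integral>\<^sup>+w. h w \<partial>lborel) = (\<integral>\<^sup>+x. \<integral>\<^sup>+w. h (x, w) \<partial>lborel \<partial>lborel)"
    if "h \<in> borel_measurable borel" for h :: "real \<times> real \<times> real \<Rightarrow> ennreal"
    using that lborel.nn_integral_fst[of h "lborel :: real measure"]
    by (simp add: lborel_prod borel_prod)
  have snd: "S = (\<integral>\<^sup>+y. \<integral>\<^sup>+x. (g (x, y))\<^sup>2 \<partial>lborel \<partial>lborel)"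
    unfolding S_def by (subst fst, simp, rule lborel_pair.Fubini') (simp add: borel_prod)
  have "(\<integral>\<^sup>+(x, y, z). g (x, y) * g (y, z) * g (z, x) \<partial>lborel)
      = (\<integral>\<^sup>+x. \<integral>\<^sup>+y. \<integral>\<^sup>+z. g (x, y) * g (y, z) * g (z, x) \<partial>lborel \<partial>lborel \<partial>lborel)"
  proof -
    have [measurable]: "(\<lambda>(x, y, z). g (x, y) * g (y, z) * g (z, x)) \<in> borel_measurable borel"
      unfolding borel_prod[symmetric] by measurable
    show ?thesis
      by (subst fst3, simp, subst fst) (auto simp flip: borel_prod)
  qed
  also have "\<dots> = (\<integral>\<^sup>+x. \<integral>\<^sup>+y. g (x, y) * G x y \<partial>lborel \<partial>lborel)"
    unfolding G_def by (simp add: mult.assoc nn_integral_cmult)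
  also have "\<dots> = (\<integral>\<^sup>+w. g w * (case w of (x, y) \<Rightarrow> G x y) \<partial>lborel)"
    by (subst fst) (auto simp flip: borel_prod)
  also have "\<dots>\<^sup>2 \<le> S * (\<integral>\<^sup>+w. (case w of (x, y) \<Rightarrow> G x y)\<^sup>2 \<partial>lborel)"
    unfolding S_def by (rule Cauchy_Schwarz_nn_integral) (auto simp flip: borel_prod)
  also have "(\<integral>\<^sup>+w. (case w of (x, y) \<Rightarrow> G x y)\<^sup>2 \<partial>lborel)
      = (\<integral>\<^sup>+x. \<integral>\<^sup>+y. (G x y)\<^sup>2 \<partial>lborel \<partial>lborel)"
    by (subst fst) (auto simp flip: borel_prod)
  also have "\<dots> \<le> (\<integral>\<^sup>+x. \<integral>\<^sup>+y.
      (\<integral>\<^sup>+z. (g (y, z))\<^sup>2 \<partial>lborel) * (\<integral>\<^sup>+z. (g (z, x))\<^sup>2 \<partial>lborel) \<partial>lborel \<partial>lborel)"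
    unfolding G_def by (intro nn_integral_mono Cauchy_Schwarz_nn_integral) auto
  also have "\<dots> = (\<integral>\<^sup>+x. S * (\<integral>\<^sup>+z. (g (z, x))\<^sup>2 \<partial>lborel) \<partial>lborel)"
    unfolding S_def by (subst fst) (auto simp: nn_integral_multc)
  also have "\<dots> = S * S"
    by (subst (3) snd) (simp add: nn_integral_cmult)
  finally show ?thesis
    by (simp add: S_def power3_eq_cube mult.assoc mult_left_mono)
qed

lemma graphon_measurable: "f \<in> graphons \<Longrightarrow> f \<in> borel_measurable (lebesgue_on unit_square)"
  by (simp add: graphons_def)

text \<open>
  Tonelli's theorem is applied to the uncompleted product measure, so a Lebesgue measurable
  \<open>f\<close> is replaced by a Borel function. Dominating \<open>f\<close> everywhere, with value \<open>\<infinity>\<close> on a Borel null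
  set, makes the comparison of the triple products pointwise; with mere almost everywhere equality
  one would have to pull null sets of the square back to the cube.
\<close>

lemma graphon_Borel_envelope:
  assumes f: "f \<in> graphons"
  obtains g :: "real \<times> real \<Rightarrow> ennreal"
  where "g \<in> borel_measurable borel"
    and "\<And>w. w \<in> unit_square \<Longrightarrow> ennreal (f w) \<le> g w"
    and "(\<integral>\<^sup>+w. (g w)\<^sup>2 \<partial>lborel) = (\<integral>\<^sup>+w. ennreal ((f w)\<^sup>2) \<partial>lebesgue_on unit_square)"
proof -
  define F where "F w = (if w \<in> unit_square then f w else 0)" for w
  have sq: "unit_square \<in> sets lebesgue"
    by (simp add: borel_closed closed_Times)
  have "F \<in> borel_measurable lebesgue"
    using f sq unfolding F_def graphons_def by (simp add: borel_measurable_if)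
  then obtain h where h: "h \<in> borel_measurable lborel" "AE w in lborel. F w = h w"
    using completion_ex_borel_measurable_real by blast
  obtain N where N: "\<And>w. w \<in> space lborel - N \<Longrightarrow> F w = h w" "N \<in> null_sets lborel"
    using AE_E3[OF h(2)] by blast
  have [measurable]: "h \<in> borel_measurable borel" "N \<in> sets borel"
    using h(1) null_setsD2[OF N(2)] by simp_all
  define g where "g w = ennreal (h w) + top * indicator N w" for w
  have g: "g \<in> borel_measurable lborel"
    unfolding g_def by measurable
  show thesis
  proof
    show "g \<in> borel_measurable borel" using g by simp
    show "ennreal (f w) \<le> g w" if "w \<in> unit_square" for w
      using that N(1)[of w] by (cases "w \<in> N") (auto simp: g_def F_def)
    have "(\<integral>\<^sup>+w. (g w)\<^sup>2 \<partial>lborel) = (\<integral>\<^sup>+w. ennreal ((f w)\<^sup>2) * indicator unit_square w \<partial>lborel)"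
    proof (rule nn_integral_cong_AE)
      have "AE w in lborel. w \<notin> N" using N(2) by (rule AE_not_in)
      then show "AE w in lborel. (g w)\<^sup>2 = ennreal ((f w)\<^sup>2) * indicator unit_square w"
      proof eventually_elim
        case (elim w)
        then have "h w = F w" using N(1)[of w] by simp
        then show ?case
          using elim f by (cases w) (auto simp: g_def F_def graphons_def indicator_def ennreal_power)
      qed
    qed
    also have "\<dots> = (\<integral>\<^sup>+w. ennreal ((f w)\<^sup>2) \<partial>lebesgue_on unit_square)"
      using sq by (simp add: nn_integral_restrict_space nn_integral_completion)
    finally show "(\<integral>\<^sup>+w. (g w)\<^sup>2 \<partial>lborel) = (\<integral>\<^sup>+w. ennreal ((f w)\<^sup>2) \<partial>lebesgue_on unit_square)" .
  qed
qed

lemma lmeasurable_unit_square: "unit_square \<in> lmeasurable"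
  and measure_unit_square: "measure lebesgue unit_square = 1"
proof -
  have eq: "unit_square = cbox (0, 0) (1, 1)" by (auto simp: cbox_Pair_eq)
  show "unit_square \<in> lmeasurable" unfolding eq by (rule lmeasurable_cbox)
  show "measure lebesgue unit_square = 1" unfolding eq by (simp add: content_Pair)
qed

lemma integrable_on_unit_square:
  fixes h :: "real \<times> real \<Rightarrow> real"
  assumes "h \<in> borel_measurable (lebesgue_on unit_square)"
    and "\<And>w. w \<in> unit_square \<Longrightarrow> \<bar>h w\<bar> \<le> B"
  shows "integrable (lebesgue_on unit_square) h"
proof -
  interpret finite_measure "lebesgue_on unit_square"
    using lmeasurable_unit_square by (rule finite_measure_lebesgue_on)
  show ?thesis
    using assms by (intro integrable_const_bound[where B = B] AE_I2) auto
qed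

lemma integral_const_unit_square: "(\<integral>w. c \<partial>lebesgue_on unit_square) = (c::real)"
  using lmeasurable_unit_square measure_unit_square
  by (simp add: measure_restrict_space fmeasurableD)

text \<open>
  Either the integral in \<open>triangle_fun f\<close> is the default value \<open>0\<close>, which satisfies any such bound,
  or it agrees with the nonnegative integral, which increases when \<open>f\<close> is replaced by its Borel
  envelope.
\<close>

lemma triangle_fun_le_moment:
  assumes f: "f \<in> graphons"
  shows "(6 * triangle_fun f)\<^sup>2 \<le> (\<integral>w. (f w)\<^sup>2 \<partial>lebesgue_on unit_square) ^ 3"
proof -
  let ?F = "\<lambda>(x, y, z). f (x, y) * f (y, z) * f (z, x)"
  define S where "S = (\<integral>w. (f w)\<^sup>2 \<partial>lebesgue_on unit_square)"
  have S0: "0 \<le> S" by (simp add: S_def)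
  show ?thesis
  proof (cases "integrable (lebesgue_on unit_cube) ?F")
    case False
    then show ?thesis
      using S0 by (simp add: triangle_fun_def not_integrable_integral_eq S_def)
  next
    case True
    obtain g where g: "g \<in> borel_measurable borel"
      "\<And>w. w \<in> unit_square \<Longrightarrow> ennreal (f w) \<le> g w"
      "(\<integral>\<^sup>+w. (g w)\<^sup>2 \<partial>lborel) = (\<integral>\<^sup>+w. ennreal ((f w)\<^sup>2) \<partial>lebesgue_on unit_square)"
      using graphon_Borel_envelope[OF f] by blast
    have bounds: "f (x, y) \<in> {0..1}" if "x \<in> {0..1}" "y \<in> {0..1}" for x y
      using f that by (simp add: graphons_def)
    have meas: "(\<lambda>w. (f w)\<^sup>2) \<in> borel_measurable (lebesgue_on unit_square)"
      using graphon_measurable[OF f] by (rule borel_measurable_power)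
    have "integrable (lebesgue_on unit_square) (\<lambda>w. (f w)\<^sup>2)"
      using bounds by (intro integrable_on_unit_square[OF meas, of 1])
        (auto simp: power_le_one)
    then have gS: "(\<integral>\<^sup>+w. (g w)\<^sup>2 \<partial>lborel) = ennreal S"
      unfolding g(3) S_def by (rule nn_integral_eq_integral) simp
    have nonneg: "0 \<le> ?F w" if "w \<in> unit_cube" for w
      using that bounds by (cases w) (auto intro!: mult_nonneg_nonneg)
    have "ennreal (6 * triangle_fun f) = (\<integral>\<^sup>+w. ennreal (?F w) \<partial>lebesgue_on unit_cube)"
      unfolding triangle_fun_def using nonneg
      by (subst nn_integral_eq_integral[OF True]) (auto intro!: AE_I2)
    also have "\<dots> = (\<integral>\<^sup>+w. ennreal (?F w) * indicator unit_cube w \<partial>lborel)"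
      by (subst nn_integral_restrict_space)
        (auto simp: nn_integral_completion borel_closed closed_Times)
    also have "\<dots> \<le> (\<integral>\<^sup>+(x, y, z). g (x, y) * g (y, z) * g (z, x) \<partial>lborel)"
    proof (rule nn_integral_mono)
      fix w :: "real \<times> real \<times> real"
      obtain x y z where w: "w = (x, y, z)"
        by (cases w)
      have "ennreal (f (x, y) * f (y, z) * f (z, x)) \<le> g (x, y) * g (y, z) * g (z, x)"
        if "x \<in> {0..1}" "y \<in> {0..1}" "z \<in> {0..1}"
      proof -
        have "ennreal (f (x, y) * f (y, z) * f (z, x)) =
            ennreal (f (x, y)) * ennreal (f (y, z)) * ennreal (f (z, x))"
          using bounds[of x y] bounds[of y z] bounds[of z x] that by (simp add: ennreal_mult)
        also have "\<dots> \<le> g (x, y) * g (y, z) * g (z, x)"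
          using that by (intro mult_mono g(2)) auto
        finally show ?thesis .
      qed
      then show "ennreal (?F w) * indicator unit_cube w
          \<le> (case w of (x, y, z) \<Rightarrow> g (x, y) * g (y, z) * g (z, x))"
        by (simp add: w indicator_def)
    qed
    finally have "(ennreal (6 * triangle_fun f))\<^sup>2 \<le>
        (\<integral>\<^sup>+(x, y, z). g (x, y) * g (y, z) * g (z, x) \<partial>lborel)\<^sup>2"
      by (rule power_mono) simp
    also have "\<dots> \<le> ennreal S ^ 3"
      using Cauchy_Schwarz_cycle[OF g(1)] by (simp add: gS)
    finally have "(ennreal (6 * triangle_fun f))\<^sup>2 \<le> ennreal S ^ 3" .
    moreover have "0 \<le> triangle_fun f"
      unfolding triangle_fun_def using nonneg by (auto intro!: integral_nonneg_AE AE_I2)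
    ultimately show ?thesis
      using S0 by (simp add: ennreal_power S_def)
  qed
qed

lemma triangle_fun_ge_imp_moment_ge:
  assumes f: "f \<in> graphons" and "0 \<le> c" and T: "c ^ 3 / 6 \<le> triangle_fun f"
  shows "c\<^sup>2 \<le> (\<integral>w. (f w)\<^sup>2 \<partial>lebesgue_on unit_square)"
proof (rule power_le_imp_le_base)
  have "(c\<^sup>2) ^ Suc 2 = (c ^ 3)\<^sup>2"
    by (simp add: power2_eq_square power3_eq_cube)
  also have "\<dots> \<le> (6 * triangle_fun f)\<^sup>2"
    using T \<open>0 \<le> c\<close> by (intro power_mono) auto
  also have "\<dots> \<le> (\<integral>w. (f w)\<^sup>2 \<partial>lebesgue_on unit_square) ^ Suc 2"
    using triangle_fun_le_moment[OF f] by simp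
  finally show "(c\<^sup>2) ^ Suc 2 \<le> (\<integral>w. (f w)\<^sup>2 \<partial>lebesgue_on unit_square) ^ Suc 2" .
qed simp

section \<open>When the constant is optimal\<close>

lemma integrable_rel_entropy:
  assumes f: "f \<in> graphons" and p: "0 < p" "p < 1"
  shows "integrable (lebesgue_on unit_square) (\<lambda>w. rel_entropy p (f w))"
proof -
  have "compact (rel_entropy p ` {0..1})"
    using continuous_on_rel_entropy[OF p] by (rule compact_continuous_image) simp
  then obtain B where B: "\<And>u. u \<in> {0..1} \<Longrightarrow> \<bar>rel_entropy p u\<bar> \<le> B"
    using compact_imp_bounded bounded_iff by (metis imageI real_norm_def)
  note graphon_measurable[OF f, measurable]
  have "(\<lambda>w. rel_entropy p (f w)) \<in> borel_measurable (lebesgue_on unit_square)"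
    unfolding rel_entropy_def by measurable
  then show ?thesis
    using f B by (intro integrable_on_unit_square[where B = B]) (auto simp: graphons_def)
qed

lemma entropy_fun_nonneg:
  assumes "f \<in> graphons" "0 < p" "p < 1"
  shows "0 \<le> entropy_fun p f"
  unfolding entropy_fun_def using assms
  by (intro integral_nonneg_AE AE_I2) (auto simp: graphons_def intro!: rel_entropy_nonneg)

lemma phi_le:
  assumes "0 < p" "p < 1" "f \<in> graphons" "t \<le> triangle_fun f"
  shows "phi p t \<le> entropy_fun p f"
  unfolding phi_def using assms
  by (intro cINF_lower bdd_belowI[where m = 0]) (auto intro: entropy_fun_nonneg)

lemma const_graphon: "c \<in> {0..1} \<Longrightarrow> (\<lambda>_. c) \<in> graphons"
  by (simp add: graphons_def)

lemma entropy_fun_const: "entropy_fun p (\<lambda>_. c) = rel_entropy p c"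
  unfolding entropy_fun_def by (rule integral_const_unit_square)

lemma triangle_fun_const: "triangle_fun (\<lambda>_. c) = c ^ 3 / 6"
proof -
  have eq: "unit_cube = cbox (0, 0, 0) (1, 1, 1)" by (auto simp: cbox_Pair_eq)
  have "measure (lebesgue_on unit_cube) unit_cube = 1"
    unfolding eq by (subst measure_restrict_space) (auto simp: content_Pair)
  moreover have "(\<lambda>(x, y, z). c * c * c) = (\<lambda>_ :: real \<times> real \<times> real. c * c * c)"
    by auto
  ultimately show ?thesis
    by (simp add: triangle_fun_def power3_eq_cube)
qed

lemma const_optimizer:
  assumes p: "0 < p" "p \<le> c" and c: "c < 1" "c \<noteq> 1/2"
    and slope: "- logit p \<le> logit c / (2 * c - 1)"
  shows "optimizer p (c ^ 3 / 6) (\<lambda>_. c)"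
proof -
  define l where "l = (logit c - logit p) / (4 * c)"
  have l0: "0 \<le> l"
    using logit_mono[of p c] p c by (simp add: l_def)
  have "rel_entropy p c \<le> entropy_fun p f"
    if f: "f \<in> graphons" "c ^ 3 / 6 \<le> triangle_fun f" for f
  proof -
    let ?S = "\<integral>w. (f w)\<^sup>2 \<partial>lebesgue_on unit_square"
    have "(\<lambda>w. (f w)\<^sup>2) \<in> borel_measurable (lebesgue_on unit_square)"
      using graphon_measurable[OF f(1)] by (rule borel_measurable_power)
    then have int: "integrable (lebesgue_on unit_square) (\<lambda>w. (f w)\<^sup>2)"
      using f by (intro integrable_on_unit_square[where B = 1])
        (auto simp: graphons_def power_le_one)
    have int_const: "integrable (lebesgue_on unit_square) (\<lambda>w. d)" for d :: real
      by (rule integrable_on_unit_square[where B = "\<bar>d\<bar>"]) auto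
    have "c\<^sup>2 \<le> ?S"
      using f p by (intro triangle_fun_ge_imp_moment_ge) auto
    then have "0 \<le> l * (?S - c\<^sup>2)"
      using l0 by simp
    then have "rel_entropy p c \<le> (rel_entropy p c - l * c\<^sup>2) + l * ?S"
      by (simp add: algebra_simps)
    also have "\<dots> = (\<integral>w. (rel_entropy p c - l * c\<^sup>2) + l * (f w)\<^sup>2 \<partial>lebesgue_on unit_square)"
      by (subst Bochner_Integration.integral_add)
        (simp_all only: int int_const integrable_mult_right integral_const_unit_square
          integral_mult_right_zero)
    also have "\<dots> \<le> entropy_fun p f"
      unfolding entropy_fun_def
    proof (rule integral_mono)
      show "integrable (lebesgue_on unit_square) (\<lambda>w. (rel_entropy p c - l * c\<^sup>2) + l * (f w)\<^sup>2)"
        by (intro Bochner_Integration.integrable_add int_const integrable_mult_right int)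
      show "integrable (lebesgue_on unit_square) (\<lambda>w. rel_entropy p (f w))"
        using f p c by (intro integrable_rel_entropy) auto
      fix w assume "w \<in> space (lebesgue_on unit_square)"
      then have "f w \<in> {0..1}"
        using f by (auto simp: graphons_def)
      then show "(rel_entropy p c - l * c\<^sup>2) + l * (f w)\<^sup>2 \<le> rel_entropy p (f w)"
        using rel_entropy_supporting_parabola[OF p c slope, of "f w", folded l_def]
        by (simp add: right_diff_distrib)
    qed
    finally show ?thesis .
  qed
  then have "rel_entropy p c \<le> phi p (c ^ 3 / 6)"
    unfolding phi_def using const_graphon[of c] triangle_fun_const[of c] p c
    by (intro cINF_greatest) auto
  moreover have "phi p (c ^ 3 / 6) \<le> rel_entropy p c"
    using phi_le[of p "\<lambda>_. c"] const_graphon[of c] p c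
    by (simp add: triangle_fun_const entropy_fun_const)
  ultimately show ?thesis
    using p c by (simp add: optimizer_def const_graphon triangle_fun_const entropy_fun_const)
qed

text \<open>
  The condition \<open>- logit p \<le> logit c / (2 c - 1)\<close> is continuous in \<open>c\<close> and strict at \<open>c = p\<close>; for
  \<open>c < 1/2\<close>, multiplying by the negative \<open>2 c - 1\<close> turns it into
  \<open>logit c \<le> logit p * (1 - 2 c)\<close>.
\<close>

lemma eventually_const_optimizer_right:
  assumes p: "0 < p" "p < 1/2"
  shows "\<forall>\<^sub>F c in at_right p. optimizer p (c ^ 3 / 6) (\<lambda>_. c)"
proof -
  have neg: "logit p < 0"
    using p by (simp add: logit_eq)
  have "isCont (\<lambda>c. ln c - ln (1 - c) - logit p * (1 - 2 * c)) p"
    using p by (intro continuous_intros) auto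
  then have "((\<lambda>c. ln c - ln (1 - c) - logit p * (1 - 2 * c)) \<longlongrightarrow>
      ln p - ln (1 - p) - logit p * (1 - 2 * p)) (at_right p)"
    by (simp add: isCont_def filterlim_at_split)
  moreover have "ln p - ln (1 - p) - logit p * (1 - 2 * p) < 0"
    using p neg by (simp add: logit_eq[symmetric] algebra_simps mult_pos_neg)
  ultimately have "\<forall>\<^sub>F c in at_right p. ln c - ln (1 - c) - logit p * (1 - 2 * c) < 0"
    by (rule order_tendstoD)
  moreover have "\<forall>\<^sub>F c in at_right p. c \<in> {p<..<1/2}"
    using p by (intro eventually_at_right_real) auto
  ultimately show ?thesis
  proof eventually_elim
    case (elim c)
    then have "- logit p \<le> logit c / (2 * c - 1)"
      using p by (simp add: neg_le_divide_eq logit_eq[of c] algebra_simps)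
    then show ?case
      using elim p by (intro const_optimizer) auto
  qed
qed

lemma const_optimizer_near_1:
  assumes p: "0 < p" "p < 1/2" and c: "1 - p \<le> c" "c < 1"
  shows "optimizer p (c ^ 3 / 6) (\<lambda>_. c)"
proof (rule const_optimizer)
  have "- logit p = logit (1 - p)"
    using p by (simp add: logit_compl)
  also have "\<dots> \<le> logit c"
    using p c by (intro logit_mono) auto
  also have "\<dots> \<le> logit c / (2 * c - 1)"
    using logit_mono[of "1/2" c] p c by (simp add: le_divide_eq mult_left_le)
  finally show "- logit p \<le> logit c / (2 * c - 1)" .
qed (use p c in auto)

section \<open>A planted clique beats the constant\<close>

definition clique :: "real \<Rightarrow> real \<times> real \<Rightarrow> real" where
  "clique p w = (if w \<in> {0..1/2} \<times> {0..1/2} then 1 else p)"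

lemma clique_measurable: "clique p \<in> borel_measurable borel"
proof -
  have "clique p = (\<lambda>w. p + (1 - p) * indicator ({0..1/2} \<times> {0..1/2}) w)"
    by (auto simp: clique_def indicator_def)
  then show ?thesis
    by (simp add: borel_closed closed_Times)
qed

lemma clique_graphon: "p \<in> {0..1} \<Longrightarrow> clique p \<in> graphons"
  using clique_measurable[of p]
  by (auto simp: graphons_def clique_def intro!: measurable_restrict_space1 measurable_completion)

lemma measure_box_pair:
  "measure lebesgue ({0..1/2} \<times> {0..1/2} :: (real \<times> real) set) = 1/4"
  "measure lebesgue ({0..1/2} \<times> {0..1/2} \<times> {0..1/2} :: (real \<times> real \<times> real) set) = 1/8"
proof -
  have eq: "({0..1/2} \<times> {0..1/2} :: (real \<times> real) set) = cbox (0, 0) (1/2, 1/2)"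
    "({0..1/2} \<times> {0..1/2} \<times> {0..1/2} :: (real \<times> real \<times> real) set)
      = cbox (0, 0, 0) (1/2, 1/2, 1/2)"
    by (auto simp: cbox_Pair_eq)
  show "measure lebesgue ({0..1/2} \<times> {0..1/2} :: (real \<times> real) set) = 1/4"
    unfolding eq(1) by (simp add: content_Pair)
  show "measure lebesgue ({0..1/2} \<times> {0..1/2} \<times> {0..1/2} :: (real \<times> real \<times> real) set) = 1/8"
    unfolding eq(2) by (simp add: content_Pair)
qed

lemma entropy_fun_clique:
  assumes "0 < p" "p < 1"
  shows "entropy_fun p (clique p) = - ln p / 8"
proof -
  let ?Q = "{0..1/2} \<times> {0..1/2} :: (real \<times> real) set"
  have "measure (lebesgue_on unit_square) ?Q = measure lebesgue ?Q"
    by (intro measure_restrict_space) (auto simp: borel_closed closed_Times)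
  then have Q: "measure (lebesgue_on unit_square) ?Q = 1/4"
    by (simp only: measure_box_pair)
  have Q': "?Q \<inter> unit_square = ?Q"
    by auto
  have "entropy_fun p (clique p) =
      (\<integral>w. indicator ?Q w *\<^sub>R (- ln p / 2) \<partial>lebesgue_on unit_square)"
    unfolding entropy_fun_def using assms
    by (intro Bochner_Integration.integral_cong)
      (auto simp: clique_def rel_entropy_def indicator_def ln_div)
  also have "\<dots> = - ln p / 8"
    by (simp add: Q Q' del: Times_Int_Times)
  finally show ?thesis .
qed

text \<open>The triangles inside the clique alone have density \<open>(1/2)\<^sup>3 / 6\<close>.\<close>

lemma triangle_fun_clique:
  assumes p: "p \<in> {0..1}"
  shows "1/48 \<le> triangle_fun (clique p)"
proof -
  let ?F = "\<lambda>(x, y, z). clique p (x, y) * clique p (y, z) * clique p (z, x)"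
  let ?Q = "{0..1/2} \<times> {0..1/2} \<times> {0..1/2} :: (real \<times> real \<times> real) set"
  have cube: "unit_cube \<in> lmeasurable"
  proof -
    have "unit_cube = cbox (0, 0, 0) (1, 1, 1)" by (auto simp: cbox_Pair_eq)
    then show ?thesis by (metis lmeasurable_cbox)
  qed
  interpret finite_measure "lebesgue_on unit_cube"
    using cube by (rule finite_measure_lebesgue_on)
  have Q: "?Q \<in> sets (lebesgue_on unit_cube)"
    using cube by (subst sets_restrict_space_iff) (auto simp: borel_closed closed_Times)
  have [measurable]: "clique p \<in> borel_measurable (borel \<Otimes>\<^sub>M borel)"
    using clique_measurable by (simp add: borel_prod)
  have "?F \<in> borel_measurable (borel \<Otimes>\<^sub>M (borel \<Otimes>\<^sub>M borel))"
    by measurable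
  then have "?F \<in> borel_measurable lborel"
    by (simp add: borel_prod)
  then have meas: "?F \<in> borel_measurable (lebesgue_on unit_cube)"
    by (intro measurable_restrict_space1 measurable_completion)
  have le1: "clique p w \<le> 1" "0 \<le> clique p w" for w
    using p by (auto simp: clique_def)
  have intF: "integrable (lebesgue_on unit_cube) ?F"
    using meas
    by (rule integrable_const_bound[where B = 1, rotated])
      (auto intro!: AE_I2 mult_le_one mult_nonneg_nonneg simp: le1 abs_mult)
  have intQ: "integrable (lebesgue_on unit_cube) (indicator ?Q :: _ \<Rightarrow> real)"
    using Q by (intro integrable_const_bound[where B = 1] borel_measurable_indicator AE_I2) auto
  have "(\<integral>w. indicator ?Q w \<partial>lebesgue_on unit_cube) \<le> (\<integral>w. ?F w \<partial>lebesgue_on unit_cube)"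
  proof (rule integral_mono[OF intQ intF])
    show "indicator ?Q w \<le> ?F w" for w
      by (cases w) (auto simp: le1 indicator_def, auto simp: clique_def)
  qed
  then have "(\<integral>w. indicator ?Q w \<partial>lebesgue_on unit_cube) \<le> 6 * triangle_fun (clique p)"
    by (simp only: triangle_fun_def)
  moreover have "(\<integral>w. indicator ?Q w \<partial>lebesgue_on unit_cube) = measure (lebesgue_on unit_cube) ?Q"
  proof -
    have "?Q \<inter> unit_cube = ?Q" by auto
    then show ?thesis by (simp del: Times_Int_Times)
  qed
  moreover have "measure (lebesgue_on unit_cube) ?Q = measure lebesgue ?Q"
    using cube by (intro measure_restrict_space) auto
  ultimately show ?thesis
    by (simp only: measure_box_pair)
qed

text \<open>
  Since \<open>I\<^sub>p(1/2) = - (2 ln 2 + ln p + ln (1 - p)) / 4\<close>, the inequality reduces to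
  \<open>ln p + 4 ln 2 + 2 ln (1 - p) < 0\<close>, for which \<open>p < 1/16\<close> suffices.
\<close>

lemma clique_entropy_less:
  assumes p: "0 < p" "p \<le> 1/20"
  shows "- ln p / 8 < rel_entropy p (1/2)"
proof -
  have "ln p < ln (1/16)"
    using p by (subst ln_less_cancel_iff) auto
  also have "ln (1/16 :: real) = - 4 * ln 2"
    using ln_realpow[of 2 4] by (simp add: ln_div)
  finally have "ln p < - 4 * ln 2" .
  moreover have "ln (1 - p) < 0"
    using p by simp
  moreover have "rel_entropy p (1/2) = - (2 * ln 2 + ln p + ln (1 - p)) / 4"
    using p by (simp add: rel_entropy_eq ln_div field_simps)
  ultimately show ?thesis
    by simp
qed

lemma ae_constant_graphon_entropy:
  assumes f: "f \<in> graphons" "ae_constant f"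
  obtains c where "c \<in> {0..1}" "entropy_fun p f = rel_entropy p c"
    "(\<integral>w. (f w)\<^sup>2 \<partial>lebesgue_on unit_square) = c\<^sup>2"
proof -
  obtain c where c: "AE w in lebesgue_on unit_square. f w = c"
    using f(2) by (auto simp: ae_constant_def)
  note graphon_measurable[OF f(1), measurable]
  have mean: "(\<integral>w. f w \<partial>lebesgue_on unit_square) = (\<integral>w. c \<partial>lebesgue_on unit_square)"
    using c by (intro integral_cong_AE) auto
  have "0 \<le> (\<integral>w. f w \<partial>lebesgue_on unit_square)"
    using f(1) by (intro integral_nonneg_AE AE_I2) (auto simp: graphons_def)
  moreover have "(\<integral>w. f w \<partial>lebesgue_on unit_square) \<le> (\<integral>w. 1 \<partial>lebesgue_on unit_square)"
    using f(1) by (intro integral_mono integrable_on_unit_square[where B = 1])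
      (auto simp: graphons_def)
  ultimately have "c \<in> {0..1}"
    unfolding mean integral_const_unit_square by simp
  moreover have "entropy_fun p f = (\<integral>w. rel_entropy p c \<partial>lebesgue_on unit_square)"
    unfolding entropy_fun_def rel_entropy_def using c
    by (intro integral_cong_AE) auto
  moreover have "(\<integral>w. (f w)\<^sup>2 \<partial>lebesgue_on unit_square) = (\<integral>w. c\<^sup>2 \<partial>lebesgue_on unit_square)"
    using c by (intro integral_cong_AE) auto
  ultimately show thesis
    using that by (simp only: integral_const_unit_square)
qed

lemma rel_entropy_mono:
  assumes "0 < p" "p \<le> a" "a \<le> b" "b \<le> 1" "a < 1"
  shows "rel_entropy p a \<le> rel_entropy p b"
proof -
  have "0 \<le> 1/2 * (logit a - logit p) * (b - a)"
    using logit_mono[of p a] assms by simp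
  moreover have "0 \<le> rel_entropy a b"
    using assms by (intro rel_entropy_nonneg) auto
  ultimately show ?thesis
    using rel_entropy_change_base[of p a b] assms by simp
qed

text \<open>
  An admissible constant is at least \<open>1/2\<close>, hence costs at least \<open>I\<^sub>p(1/2)\<close>, which the clique
  undercuts.
\<close>

lemma optimizer_not_ae_constant:
  assumes p: "0 < p" "p \<le> 1/20" and opt: "optimizer p (1/48) f"
  shows "\<not> ae_constant f"
proof
  assume "ae_constant f"
  have f: "f \<in> graphons" "1/48 \<le> triangle_fun f" "entropy_fun p f = phi p (1/48)"
    using opt by (auto simp: optimizer_def)
  obtain c where c: "c \<in> {0..1}" "entropy_fun p f = rel_entropy p c"
    "(\<integral>w. (f w)\<^sup>2 \<partial>lebesgue_on unit_square) = c\<^sup>2"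
    using ae_constant_graphon_entropy[OF f(1) \<open>ae_constant f\<close>] by blast
  have "(1/2)\<^sup>2 \<le> c\<^sup>2"
    using triangle_fun_ge_imp_moment_ge[OF f(1), of "1/2"] f(2) c(3)
    by (simp add: power3_eq_cube)
  then have "1/2 \<le> c"
    using c(1) by (intro power2_le_imp_le[of "1/2" c]) auto
  then have "rel_entropy p (1/2) \<le> phi p (1/48)"
    using rel_entropy_mono[of p "1/2" c] p c f(3) by simp
  also have "\<dots> \<le> entropy_fun p (clique p)"
    using p by (intro phi_le clique_graphon triangle_fun_clique) auto
  also have "\<dots> < rel_entropy p (1/2)"
    using clique_entropy_less[OF p] entropy_fun_clique[of p] p by simp
  finally show False by simp
qed

section \<open>The double phase transition\<close>

lemma cube_root_between:
  fixes a b t :: real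
  assumes "0 \<le> a" "0 \<le> b" "a ^ 3 / 6 < t" "t < b ^ 3 / 6"
  shows "((6 * t) powr (1/3)) ^ 3 / 6 = t" "a < (6 * t) powr (1/3)" "(6 * t) powr (1/3) < b"
proof -
  have "0 < t"
    using assms(1,3) zero_le_power[of a 3] by linarith
  then have cube: "((6 * t) powr (1/3)) ^ 3 = 6 * t"
    by (simp add: powr_power)
  show "((6 * t) powr (1/3)) ^ 3 / 6 = t"
    using cube by simp
  show "a < (6 * t) powr (1/3)"
    by (rule power_less_imp_less_base[of _ 3]) (use cube assms in auto)
  show "(6 * t) powr (1/3) < b"
    by (rule power_less_imp_less_base[of _ 3]) (use cube assms in auto)
qed

theorem theorem4p5:
  "\<exists>p0::real. p0 > 0 \<and>
     (\<forall>p. 0 < p \<and> p \<le> p0 \<longrightarrow>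
       (\<exists>t' t''. p ^ 3 / 6 < t' \<and> t' < t'' \<and> t'' < 1 / 6 \<and>
          (\<forall>t \<in> {p ^ 3 / 6<..<t'} \<union> {t''<..<1 / 6}.
             optimizer p t (\<lambda>_. (6 * t) powr (1 / 3))) \<and>
          (\<exists>S. S \<noteq> {} \<and> S \<subseteq> {t'<..<t''} \<and>
             (\<forall>t\<in>S. \<forall>f. optimizer p t f \<longrightarrow> \<not> ae_constant f))))"
proof (rule exI[of _ "1/20"], intro conjI allI impI)
  fix p :: real assume "0 < p \<and> p \<le> 1/20"
  then have p: "0 < p" "p \<le> 1/20" by auto
  obtain b where b: "p < b" "\<And>c. p < c \<Longrightarrow> c < b \<Longrightarrow> optimizer p (c ^ 3 / 6) (\<lambda>_. c)"
    using eventually_const_optimizer_right[of p] p by (auto simp: eventually_at_right_field)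
  \<comment> \<open>The cap \<open>1/4\<close> keeps \<open>t' = d\<^sup>3 / 6\<close> below \<open>1/48\<close>, the value at which the clique wins.\<close>
  define d where "d = min b (1/4)"
  have d: "p < d" "d \<le> b" "d \<le> 1/4"
    using b p by (auto simp: d_def)
  have t': "p ^ 3 / 6 < d ^ 3 / 6" "d ^ 3 / 6 < 1/48"
    using power_strict_mono[of p d 3] power_mono[of d "1/4" 3] d p
    by (auto simp: power3_eq_cube)
  have t'': "1/48 < (1 - p) ^ 3 / 6" "(1 - p) ^ 3 / 6 < 1/6"
    using power_strict_mono[of "1/2" "1 - p" 3] power_strict_mono[of "1 - p" 1 3] p
    by (auto simp: power3_eq_cube)
  have "optimizer p t (\<lambda>_. (6 * t) powr (1/3))"
    if "t \<in> {p ^ 3 / 6<..<d ^ 3 / 6} \<union> {(1 - p) ^ 3 / 6<..<1/6}" for t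
    using that
  proof
    assume "t \<in> {p ^ 3 / 6<..<d ^ 3 / 6}"
    then show ?thesis
      using b(2)[of "(6 * t) powr (1/3)"] cube_root_between[of p d t] d p by simp
  next
    assume "t \<in> {(1 - p) ^ 3 / 6<..<1/6}"
    then show ?thesis
      using const_optimizer_near_1[of p "(6 * t) powr (1/3)"] cube_root_between[of "1 - p" 1 t] p
      by simp
  qed
  moreover have "\<forall>t\<in>{1/48}. \<forall>f. optimizer p t f \<longrightarrow> \<not> ae_constant f"
    using optimizer_not_ae_constant[OF p] by simp
  ultimately show "\<exists>t' t''. p ^ 3 / 6 < t' \<and> t' < t'' \<and> t'' < 1 / 6 \<and>
          (\<forall>t \<in> {p ^ 3 / 6<..<t'} \<union> {t''<..<1 / 6}.
             optimizer p t (\<lambda>_. (6 * t) powr (1 / 3))) \<and>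
          (\<exists>S. S \<noteq> {} \<and> S \<subseteq> {t'<..<t''} \<and>
             (\<forall>t\<in>S. \<forall>f. optimizer p t f \<longrightarrow> \<not> ae_constant f))"
    using t' t''
    by (intro exI[of _ "d ^ 3 / 6"] exI[of _ "(1 - p) ^ 3 / 6"] exI[of _ "{1/48::real}"] conjI) auto
qed simp

end
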